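(* Let $G=(V,E)$ be a graph with $|V|=n$, non-negative edge weights $w:E\to\mathbb{R}_{\ge0}$, and $c:V\to\mathbb{N}$ with $c_v\le d(v)$ for all $v$. Consider the following algorithm. For each $v$ let $H(v)$ be a set of $c_v$ heaviest edges incident on $v$ (ties broken arbitrarily). Let $T=\{e=(u,v)\in E: e\in H(u)\text{ and }e\in H(v)\}$, and let $E_2$ be the set of edges $e=(u,v)$ lying in exactly one of $H(u),H(v)$; orient such an edge from $u$ to $v$ if $e\notin H(u)$ and $e\in H(v)$. Label the vertices by distinct integers $0,\dots,n-1$ and let $k=\lceil\log_2 n\rceil$. For $r=1,\dots,k$ let $A_r$ be the set of edges of $E_2$ directed from $u$ to $v$ such that the labels of $u$ and $v$ agree in their $r-1$ least significant binary digits and the $r$-th least significant digit is $0$ for $u$ and $1$ for $v$; let $B_r$ be defined in the same way but with the $r$-th digit $1$ for $u$ and $0$ for $v$. Output the set of maximum total weight among $T,A_1,\dots,A_k,B_1,\dots,B_k$. Then the output is a feasible PDBEP solution, and its weight is at least $\mathrm{OPT}/(2+2\lceil\log_2 n\rceil)$, where $\mathrm{OPT}$ is the maximum total weight of a feasible PDBEP solution.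
   Context: Weighted PDBEP: given $G=(V,E)$, $c:V\to\mathbb{N}$ and non-negative edge weights $w$, a set $E'\subseteq E$ is feasible if for every $(u,v)\in E'$, $d'_u\le c_u$ or $d'_v\le c_v$, with $d'_x$ the degree of $x$ in $(V,E')$; the goal is to maximize $w(E')=\sum_{e\in E'}w(e)$. $d(v)$ is the degree of $v$ in $G$. *)

theory Defs
  imports Complex_Main
begin

(* A finite simple undirected graph; an edge (u,v) is the two-element set {u, v}. *)
definition simple_graph :: "'a set \<Rightarrow> 'a set set \<Rightarrow> bool" where
  "simple_graph V E \<longleftrightarrow> finite V \<and> (\<forall>e\<in>E. e \<subseteq> V \<and> card e = 2)"

definition incident_edges :: "'a set set \<Rightarrow> 'a \<Rightarrow> 'a set set" where
  "incident_edges E v = {e \<in> E. v \<in> e}"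

definition degree :: "'a set set \<Rightarrow> 'a \<Rightarrow> nat" where
  "degree E v = card (incident_edges E v)"

definition weight :: "('a set \<Rightarrow> real) \<Rightarrow> 'a set set \<Rightarrow> real" where
  "weight w F = (\<Sum>e\<in>F. w e)"

definition pdbep_feasible :: "'a set set \<Rightarrow> ('a \<Rightarrow> nat) \<Rightarrow> 'a set set \<Rightarrow> bool" where
  "pdbep_feasible E c F \<longleftrightarrow>
     F \<subseteq> E \<and> (\<forall>u v. {u, v} \<in> F \<longrightarrow> degree F u \<le> c u \<or> degree F v \<le> c v)"

(* The set of feasible solutions is finite when E is, and always contains the empty set,
   so Max is a genuine maximum for finite graphs. *)
definition pdbep_opt :: "'a set set \<Rightarrow> ('a \<Rightarrow> nat) \<Rightarrow> ('a set \<Rightarrow> real) \<Rightarrow> real" where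
  "pdbep_opt E c w = Max (weight w ` {F. pdbep_feasible E c F})"

(* Ties between edges of equal weight may be broken in any way, so this is a predicate on S
   rather than a function. *)
definition heaviest_edges ::
  "'a set set \<Rightarrow> ('a set \<Rightarrow> real) \<Rightarrow> 'a \<Rightarrow> nat \<Rightarrow> 'a set set \<Rightarrow> bool" where
  "heaviest_edges E w v m S \<longleftrightarrow>
     S \<subseteq> incident_edges E v \<and> card S = m \<and>
     (\<forall>e\<in>S. \<forall>f\<in>incident_edges E v - S. w f \<le> w e)"

definition T_set :: "'a set set \<Rightarrow> ('a \<Rightarrow> 'a set set) \<Rightarrow> 'a set set" where
  "T_set E H = {{u, v} | u v. {u, v} \<in> E \<and> {u, v} \<in> H u \<and> {u, v} \<in> H v}"

definition E2_set :: "'a set set \<Rightarrow> ('a \<Rightarrow> 'a set set) \<Rightarrow> 'a set set" where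
  "E2_set E H = {{u, v} | u v. {u, v} \<in> E \<and> ({u, v} \<in> H u) \<noteq> ({u, v} \<in> H v)}"

definition directed :: "'a set set \<Rightarrow> ('a \<Rightarrow> 'a set set) \<Rightarrow> 'a \<Rightarrow> 'a \<Rightarrow> bool" where
  "directed E H u v \<longleftrightarrow> {u, v} \<in> E2_set E H \<and> {u, v} \<notin> H u \<and> {u, v} \<in> H v"

(* The constant bit counts positions from 0, so the r-th least significant digit (r \<ge> 1)
   is the one at position r - 1. *)
definition A_set ::
  "'a set set \<Rightarrow> ('a \<Rightarrow> 'a set set) \<Rightarrow> ('a \<Rightarrow> nat) \<Rightarrow> nat \<Rightarrow> 'a set set" where
  "A_set E H lab r = {{u, v} | u v. directed E H u v \<and>
     (\<forall>i < r - 1. bit (lab u) i = bit (lab v) i) \<and>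
     \<not> bit (lab u) (r - 1) \<and> bit (lab v) (r - 1)}"

definition B_set ::
  "'a set set \<Rightarrow> ('a \<Rightarrow> 'a set set) \<Rightarrow> ('a \<Rightarrow> nat) \<Rightarrow> nat \<Rightarrow> 'a set set" where
  "B_set E H lab r = {{u, v} | u v. directed E H u v \<and>
     (\<forall>i < r - 1. bit (lab u) i = bit (lab v) i) \<and>
     bit (lab u) (r - 1) \<and> \<not> bit (lab v) (r - 1)}"

definition candidates ::
  "'a set set \<Rightarrow> ('a \<Rightarrow> 'a set set) \<Rightarrow> ('a \<Rightarrow> nat) \<Rightarrow> nat \<Rightarrow> 'a set set set" where
  "candidates E H lab k = {T_set E H} \<union> A_set E H lab ` {1..k} \<union> B_set E H lab ` {1..k}"

(* Several candidates may attain the maximum; any of them may be output. *)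
definition max_weight_candidate ::
  "('a set \<Rightarrow> real) \<Rightarrow> 'a set set set \<Rightarrow> 'a set set \<Rightarrow> bool" where
  "max_weight_candidate w \<C> S \<longleftrightarrow> S \<in> \<C> \<and> (\<forall>C\<in>\<C>. weight w C \<le> weight w S)"

end

theory Submission
  imports Defs
begin

text \<open>Each edge of a feasible solution has an endpoint whose degree respects its bound, and the
  edges charged to such an endpoint \<open>v\<close> weigh at most as much as \<open>H v\<close>. As \<open>H\<close> counts the edges
  of \<open>T\<close> twice and those of \<open>E\<^sub>2\<close> once, OPT is at most \<open>2 w(T) + w(E\<^sub>2)\<close>. Sorting the edges of
  \<open>E\<^sub>2\<close> by the lowest binary digit in which the labels of their endpoints differ, one sees that
  the \<open>2k\<close> sets \<open>A\<^sub>r\<close>, \<open>B\<^sub>r\<close> cover \<open>E\<^sub>2\<close>; in each of them a vertex is either only a tail or only a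
  head, and a head \<open>v\<close> meets only edges of \<open>H v\<close>.\<close>

section \<open>Inequalities between finite sums\<close>

lemma sum_UN_le:
  fixes f :: "'b \<Rightarrow> 'c::ordered_ab_group_add"
  assumes "finite I" "\<And>i. i \<in> I \<Longrightarrow> finite (A i)"
    and "\<And>i x. i \<in> I \<Longrightarrow> x \<in> A i \<Longrightarrow> 0 \<le> f x"
  shows "sum f (\<Union>i\<in>I. A i) \<le> (\<Sum>i\<in>I. sum f (A i))"
  using assms
proof (induction I rule: finite_induct)
  case empty
  then show ?case by simp
next
  case (insert i I)
  have "sum f (A i \<union> (\<Union>i\<in>I. A i)) \<le> sum f (A i) + sum f (\<Union>i\<in>I. A i)"
    using insert by (subst sum.union_inter [symmetric]) (auto intro!: sum_nonneg)
  also have "\<dots> \<le> sum f (A i) + (\<Sum>i\<in>I. sum f (A i))"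
    using insert by (intro add_left_mono) auto
  finally show ?case using insert by simp
qed

text \<open>An exchange argument: the cardinality bound passes to the differences, so
  \<open>F - S\<close> injects into \<open>S - F\<close>, and each element goes to one with at least
  as large a value. What the injection misses contributes non-negatively, and
  \<open>F \<inter> S\<close> is common to both sums.\<close>

lemma sum_le_sum_dominating:
  fixes f :: "'b \<Rightarrow> real"
  assumes "finite S" "finite F" "card F \<le> card S"
    and dom: "\<And>x y. x \<in> S \<Longrightarrow> y \<in> F - S \<Longrightarrow> f y \<le> f x"
    and nonneg: "\<And>x. x \<in> S \<Longrightarrow> 0 \<le> f x"
  shows "sum f F \<le> sum f S"
proof -
  have "card (F - S) \<le> card (S - F)"
    using assms(1-3) by (simp add: card_Diff_subset_Int Int_commute diff_le_mono)
  then obtain g where g: "g ` (F - S) \<subseteq> S - F" "inj_on g (F - S)"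
    using assms(1,2) inj_on_iff_card_le [of "F - S" "S - F"] by auto
  have "sum f (F - S) \<le> (\<Sum>x\<in>F - S. f (g x))"
    using g by (intro sum_mono dom) auto
  also have "\<dots> = sum f (g ` (F - S))"
    using g by (simp add: sum.reindex)
  also have "\<dots> \<le> sum f (S - F)"
    using g assms(1) nonneg by (intro sum_mono2) auto
  finally show ?thesis
    using sum.Int_Diff [OF assms(1), of f F] sum.Int_Diff [OF assms(2), of f S]
    by (simp add: Int_commute)
qed

lemma simple_graph_finite_edges: "simple_graph V E \<Longrightarrow> finite E"
  unfolding simple_graph_def by (rule finite_subset [of _ "Pow V"]) auto

text \<open>The exchange argument at one vertex. It uses only weak domination between
  \<open>S\<close> and the other edges at \<open>v\<close>, so the way ties are broken does not
  matter.\<close>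

lemma heaviest_edges_weight_ge:
  assumes "heaviest_edges E w v m S" "finite E" "\<forall>e\<in>E. 0 \<le> w e"
    and "F \<subseteq> incident_edges E v" "card F \<le> m"
  shows "weight w F \<le> weight w S"
proof -
  have "finite (incident_edges E v)" "S \<subseteq> incident_edges E v"
    using assms(1,2) by (simp_all add: incident_edges_def heaviest_edges_def)
  then have "finite S" "finite F"
    using assms(4) finite_subset by metis+
  then show ?thesis
    using assms unfolding weight_def heaviest_edges_def
    by (intro sum_le_sum_dominating) (auto simp: incident_edges_def)
qed

section \<open>Feasibility of the candidates\<close>

lemma pdbep_feasibleI:
  assumes "F \<subseteq> E" "\<And>v. v \<in> V \<Longrightarrow> finite (H v) \<and> card (H v) \<le> c v"
    and "\<And>e. e \<in> F \<Longrightarrow> \<exists>v\<in>e \<inter> V. incident_edges F v \<subseteq> H v"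
  shows "pdbep_feasible E c F"
  unfolding pdbep_feasible_def
proof (intro conjI allI impI)
  fix u v assume "{u, v} \<in> F"
  then obtain x where x: "x = u \<or> x = v" "x \<in> V" "incident_edges F x \<subseteq> H x"
    using assms(3) by blast
  then have "degree F x \<le> c x"
    using assms(2) [of x] card_mono [of "H x" "incident_edges F x"] by (auto simp: degree_def)
  then show "degree F u \<le> c u \<or> degree F v \<le> c v"
    using x by blast
qed (fact assms(1))

text \<open>The witness required by \<open>pdbep_feasibleI\<close> is either end of an edge when the
  candidate is \<open>T_set E H\<close>, and the head of the edge otherwise.\<close>

lemma candidates_feasible:
  assumes "simple_graph V E" "\<And>v. v \<in> V \<Longrightarrow> finite (H v) \<and> card (H v) \<le> c v"
    and "C \<in> candidates E H lab k"
  shows "pdbep_feasible E c C"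
proof (rule pdbep_feasibleI)
  have sub: "e \<subseteq> V" if "e \<in> E" for e
    using that assms(1) by (auto simp: simple_graph_def)
  show "C \<subseteq> E"
    using assms(3) by (auto simp: candidates_def T_set_def A_set_def B_set_def directed_def E2_set_def)
  fix e assume e: "e \<in> C"
  with \<open>C \<subseteq> E\<close> have "e \<subseteq> V" using sub by auto
  consider "C = T_set E H" | r where "C = A_set E H lab r" | r where "C = B_set E H lab r"
    using assms(3) by (auto simp: candidates_def)
  then show "\<exists>v\<in>e \<inter> V. incident_edges C v \<subseteq> H v"
  proof cases
    case 1
    then show ?thesis
      using e \<open>e \<subseteq> V\<close> by (fastforce simp: T_set_def incident_edges_def)
  next
    case 2
    then obtain u v where "e = {u, v}" "bit (lab v) (r - 1)"
      using e by (auto simp: A_set_def)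
    \<comment> \<open>In \<open>A_set\<close> all tails have digit 0 and all heads digit 1 at
      position \<open>r - 1\<close>. Hence \<open>v\<close> is the head of every edge of
      \<open>C\<close> that it meets, and these edges lie in \<open>H v\<close>.\<close>
    moreover from this 2 have "incident_edges C v \<subseteq> H v"
      by (auto simp: A_set_def incident_edges_def directed_def)
    ultimately show ?thesis using \<open>e \<subseteq> V\<close> by auto
  next
    case 3
    then obtain u v where "e = {u, v}" "\<not> bit (lab v) (r - 1)"
      using e by (auto simp: B_set_def)
    moreover from this 3 have "incident_edges C v \<subseteq> H v"
      by (auto simp: B_set_def incident_edges_def directed_def)
    ultimately show ?thesis using \<open>e \<subseteq> V\<close> by auto
  qed
qed (use assms(2) in auto)

section \<open>Upper bound on the optimum\<close>

lemma weight_feasible_le: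
  assumes "simple_graph V E" "\<forall>e\<in>E. 0 \<le> w e" "\<forall>v\<in>V. heaviest_edges E w v (c v) (H v)"
    and F: "pdbep_feasible E c F"
  shows "weight w F \<le> (\<Sum>v\<in>V. weight w (H v))"
proof -
  \<comment> \<open>Each edge of \<open>F\<close> is charged to its ends in \<open>L\<close>.
    Feasibility provides at least one; an edge with two is counted twice, which only increases the
    bound.\<close>
  define L where "L = {v \<in> V. degree F v \<le> c v}"
  have "finite V" and fin: "finite E"
    using assms(1) simple_graph_finite_edges by (auto simp: simple_graph_def)
  have FE: "F \<subseteq> E" using F by (simp add: pdbep_feasible_def)
  have H: "H v \<subseteq> E" if "v \<in> V" for v
    using that assms(3) by (auto simp: heaviest_edges_def incident_edges_def)
  have "F \<subseteq> (\<Union>v\<in>L. incident_edges F v)"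
  proof
    fix e assume "e \<in> F"
    then have "e \<subseteq> V" "card e = 2"
      using FE assms(1) by (auto simp: simple_graph_def)
    then obtain u v where "e = {u, v}" "u \<in> V" "v \<in> V"
      by (auto simp: card_2_iff)
    with \<open>e \<in> F\<close> show "e \<in> (\<Union>v\<in>L. incident_edges F v)"
      using F unfolding pdbep_feasible_def L_def incident_edges_def by blast
  qed
  then have "F = (\<Union>v\<in>L. incident_edges F v)"
    by (auto simp: incident_edges_def)
  then have "weight w F = sum w (\<Union>v\<in>L. incident_edges F v)"
    by (simp add: weight_def)
  also have "\<dots> \<le> (\<Sum>v\<in>L. sum w (incident_edges F v))"
    using \<open>finite V\<close> fin FE assms(2) finite_subset [OF FE]
    by (intro sum_UN_le) (auto simp: L_def incident_edges_def)
  also have "\<dots> = (\<Sum>v\<in>L. weight w (incident_edges F v))"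
    by (simp add: weight_def)
  \<comment> \<open>Membership in \<open>L\<close> bounds the number of edges of \<open>F\<close> at
    \<open>v\<close> by \<open>c v\<close>, the cardinality of \<open>H v\<close>.\<close>
  also have "\<dots> \<le> (\<Sum>v\<in>L. weight w (H v))"
    using assms FE fin
    by (intro sum_mono heaviest_edges_weight_ge [of E w _ "c _"])
       (auto simp: L_def incident_edges_def degree_def)
  also have "\<dots> \<le> (\<Sum>v\<in>V. weight w (H v))"
    using \<open>finite V\<close> assms(2) H
    by (intro sum_mono2) (auto simp: L_def weight_def intro!: sum_nonneg)
  finally show ?thesis .
qed

text \<open>The comprehension only asks for some naming of the two ends; as its condition is
  symmetric in them, any naming will do.\<close>

lemma insert_in_T_set_iff:
  "{u, v} \<in> T_set E H \<longleftrightarrow> {u, v} \<in> E \<and> {u, v} \<in> H u \<and> {u, v} \<in> H v"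
  unfolding T_set_def mem_Collect_eq by (metis doubleton_eq_iff)

lemma insert_in_E2_set_iff:
  "{u, v} \<in> E2_set E H \<longleftrightarrow> {u, v} \<in> E \<and> ({u, v} \<in> H u) \<noteq> ({u, v} \<in> H v)"
  unfolding E2_set_def mem_Collect_eq by (metis doubleton_eq_iff)

text \<open>Double counting: after swapping the sums, an edge contributes once for each vertex whose
  \<open>H\<close> contains it, which is two, one or zero times according to whether it lies in
  \<open>T_set E H\<close>, in \<open>E2_set E H\<close> or in neither.\<close>

lemma sum_weight_heaviest:
  assumes "simple_graph V E" "\<And>v. v \<in> V \<Longrightarrow> H v \<subseteq> incident_edges E v"
  shows "(\<Sum>v\<in>V. weight w (H v)) = 2 * weight w (T_set E H) + weight w (E2_set E H)"
proof -
  have "finite V" and fin: "finite E"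
    using assms(1) simple_graph_finite_edges by (auto simp: simple_graph_def)
  have sub: "T_set E H \<subseteq> E" "E2_set E H \<subseteq> E"
    by (auto simp: T_set_def E2_set_def)
  have "(\<Sum>v\<in>V. weight w (H v)) = (\<Sum>v\<in>V. \<Sum>e | e \<in> E \<and> e \<in> H v. w e)"
    unfolding weight_def using assms(2)
    by (intro sum.cong) (auto simp: incident_edges_def)
  also have "\<dots> = (\<Sum>e\<in>E. \<Sum>v | v \<in> V \<and> e \<in> H v. w e)"
    using \<open>finite V\<close> fin by (rule sum.swap_restrict)
  also have "\<dots> = (\<Sum>e\<in>E. 2 * (if e \<in> T_set E H then w e else 0) +
      (if e \<in> E2_set E H then w e else 0))"
  proof (rule sum.cong)
    fix e assume "e \<in> E"
    then obtain u v where e: "e = {u, v}" "u \<noteq> v" "u \<in> V" "v \<in> V"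
      using assms(1) by (fastforce simp: simple_graph_def card_2_iff)
    have T: "e \<in> T_set E H \<longleftrightarrow> e \<in> H u \<and> e \<in> H v"
      using \<open>e \<in> E\<close> e(1) by (simp add: insert_in_T_set_iff)
    have E2: "e \<in> E2_set E H \<longleftrightarrow> (e \<in> H u) \<noteq> (e \<in> H v)"
      using \<open>e \<in> E\<close> e(1) by (simp add: insert_in_E2_set_iff)
    \<comment> \<open>Only the ends of \<open>e\<close> can count, because \<open>H x\<close>
      consists of edges at \<open>x\<close>.\<close>
    have "{x \<in> V. e \<in> H x} = {x \<in> {u, v}. e \<in> H x}"
    proof -
      have "x = u \<or> x = v" if "x \<in> V" "e \<in> H x" for x
        using assms(2) [OF that(1)] that(2) e(1) by (auto simp: incident_edges_def)
      then show ?thesis using e by auto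
    qed
    also have "\<dots> = (if e \<in> H u then {u} else {}) \<union> (if e \<in> H v then {v} else {})"
      by auto
    finally show "(\<Sum>x | x \<in> V \<and> e \<in> H x. w e) =
        2 * (if e \<in> T_set E H then w e else 0) + (if e \<in> E2_set E H then w e else 0)"
      using \<open>u \<noteq> v\<close> by (simp add: T E2)
  qed simp
  also have "\<dots> = 2 * weight w (T_set E H) + weight w (E2_set E H)"
    using fin sub
    by (simp add: sum.distrib sum_distrib_left [symmetric] weight_def sum.inter_restrict [symmetric]
        Int_absorb1)
  finally show ?thesis .
qed

section \<open>Covering \<open>E2_set\<close> by digit classes\<close>

lemma lowest_differing_bit:
  fixes a b k :: nat
  assumes "a \<noteq> b" "a < 2 ^ k" "b < 2 ^ k"
  obtains i where "i < k" "bit a i \<noteq> bit b i" "\<forall>j<i. bit a j = bit b j"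
proof -
  define i where "i = (LEAST i. bit a i \<noteq> bit b i)"
  have "\<exists>i. bit a i \<noteq> bit b i"
    using assms(1) by (auto simp: bit_eq_iff)
  then have i: "bit a i \<noteq> bit b i"
    unfolding i_def by (rule LeastI_ex)
  have min: "\<forall>j<i. bit a j = bit b j"
    unfolding i_def by (auto dest: not_less_Least)
  \<comment> \<open>Numbers below \<open>2 ^ k\<close> have no digits at position \<open>k\<close>
    or above, so they can only differ below \<open>k\<close>.\<close>
  have "take_bit k a = a" "take_bit k b = b"
    using assms by (auto simp: take_bit_nat_eq_self_iff)
  with i have "i < k"
    by (metis bit_take_bit_iff)
  with i min show thesis using that by blast
qed

text \<open>Distinct labels have a lowest differing position, which determines \<open>r\<close>; the
  digit of the tail there decides between \<open>A_set\<close> and \<open>B_set\<close>.\<close>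

lemma E2_set_subset:
  assumes "simple_graph V E" "inj_on lab V" "\<And>v. v \<in> V \<Longrightarrow> lab v < 2 ^ k"
  shows "E2_set E H \<subseteq> (\<Union>r\<in>{1..k}. A_set E H lab r) \<union> (\<Union>r\<in>{1..k}. B_set E H lab r)"
proof
  fix e assume e: "e \<in> E2_set E H"
  then obtain a b where ab: "e = {a, b}" "e \<in> E"
    by (auto simp: E2_set_def)
  \<comment> \<open>Exactly one of \<open>H a\<close> and \<open>H b\<close> contains the edge, and
    the end with that set is the head.\<close>
  with e have "directed E H a b \<or> directed E H b a"
    by (auto simp: directed_def insert_in_E2_set_iff insert_commute)
  with ab obtain u v where uv: "e = {u, v}" "e \<in> E" "directed E H u v"
    by (metis insert_commute)
  then have "u \<in> V" "v \<in> V" "u \<noteq> v"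
    using assms(1) by (auto simp: simple_graph_def)
  then have "lab u \<noteq> lab v" "lab u < 2 ^ k" "lab v < 2 ^ k"
    using assms(2,3) by (auto simp: inj_on_def)
  then obtain i where i: "i < k" "bit (lab u) i \<noteq> bit (lab v) i"
      "\<forall>j<i. bit (lab u) j = bit (lab v) j"
    by (rule lowest_differing_bit)
  \<comment> \<open>Position \<open>i\<close>, counted from 0, is the digit of index
    \<open>r = Suc i\<close>.\<close>
  then have "e \<in> A_set E H lab (Suc i) \<or> e \<in> B_set E H lab (Suc i)"
    using uv by (auto simp: A_set_def B_set_def)
  moreover have "Suc i \<in> {1..k}" using i by simp
  ultimately show "e \<in> (\<Union>r\<in>{1..k}. A_set E H lab r) \<union> (\<Union>r\<in>{1..k}. B_set E H lab r)"
    by blast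
qed

text \<open>A union bound over the \<open>2 * k\<close> covering sets, each a candidate; overlaps
  are harmless because weights are non-negative. The bound \<open>m\<close> will be the weight of
  the output.\<close>

lemma weight_E2_set_le:
  assumes "simple_graph V E" "inj_on lab V" "\<And>v. v \<in> V \<Longrightarrow> lab v < 2 ^ k"
    and nonneg: "\<forall>e\<in>E. 0 \<le> w e"
    and le: "\<And>C. C \<in> candidates E H lab k \<Longrightarrow> weight w C \<le> m"
  shows "weight w (E2_set E H) \<le> 2 * real k * m"
proof -
  let ?A = "A_set E H lab" and ?B = "B_set E H lab"
  have sub: "?A r \<subseteq> E" "?B r \<subseteq> E" for r
    by (auto simp: A_set_def B_set_def directed_def E2_set_def)
  have fin: "finite (?A r)" "finite (?B r)" for r
    using sub assms(1) simple_graph_finite_edges finite_subset by metis+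
  have nn: "0 \<le> w e" if "e \<in> ?A r \<or> e \<in> ?B r" for e r
    using that sub nonneg by blast
  have "weight w (E2_set E H) \<le> sum w ((\<Union>r\<in>{1..k}. ?A r) \<union> (\<Union>r\<in>{1..k}. ?B r))"
    unfolding weight_def using fin nn E2_set_subset [OF assms(1-3)]
    by (intro sum_mono2) auto
  also have "\<dots> \<le> sum w (\<Union>r\<in>{1..k}. ?A r) + sum w (\<Union>r\<in>{1..k}. ?B r)"
    using fin nn by (subst sum.union_inter [symmetric]) (auto intro!: sum_nonneg)
  also have "\<dots> \<le> (\<Sum>r\<in>{1..k}. sum w (?A r)) + (\<Sum>r\<in>{1..k}. sum w (?B r))"
    using fin nn by (intro add_mono sum_UN_le) auto
  also have "\<dots> \<le> (\<Sum>r\<in>{1..k}. m) + (\<Sum>r\<in>{1..k}. m)"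
    using le by (intro add_mono sum_mono) (auto simp: candidates_def weight_def)
  finally show ?thesis by (simp add: mult.commute mult.left_commute)
qed

text \<open>The second part shows that \<open>k\<close> digits suffice for labels below
  \<open>n\<close>; the first ensures that \<open>nat\<close> does not change the ceiling.\<close>

lemma ceiling_log2_of_nat:
  shows ceiling_log2_nonneg: "0 \<le> \<lceil>log 2 (real n)\<rceil>"
    and le_two_power_ceiling_log2: "n \<le> 2 ^ nat \<lceil>log 2 (real n)\<rceil>"
proof -
  \<comment> \<open>for \<open>n = 0\<close> the junk value is \<open>log 2 0 = 0\<close>\<close>
  have "0 \<le> log 2 (real n)"
    by (cases "n = 0") (auto simp: log_def)
  then show nn: "0 \<le> \<lceil>log 2 (real n)\<rceil>" by linarith
  show "n \<le> 2 ^ nat \<lceil>log 2 (real n)\<rceil>"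
  proof (cases "n = 0")
    case False
    have "log 2 (real n) \<le> real (nat \<lceil>log 2 (real n)\<rceil>)"
      using nn by simp
    then have "real n \<le> 2 powr real (nat \<lceil>log 2 (real n)\<rceil>)"
      using False by (subst (asm) log_le_iff) simp_all
    then have "real n \<le> real (2 ^ nat \<lceil>log 2 (real n)\<rceil>)"
      by (simp add: powr_realpow)
    then show ?thesis by (simp only: of_nat_le_iff)
  qed simp
qed

section \<open>The approximation ratio\<close>

theorem theorem4:
  fixes V :: "'a set" and E :: "'a set set" and w :: "'a set \<Rightarrow> real"
    and c :: "'a \<Rightarrow> nat" and H :: "'a \<Rightarrow> 'a set set" and lab :: "'a \<Rightarrow> nat"
    and n k :: nat and S :: "'a set set"
  assumes "simple_graph V E"
    and "card V = n"
    and "\<forall>e\<in>E. 0 \<le> w e"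
    and "\<forall>v\<in>V. c v \<le> degree E v"
    and "\<forall>v\<in>V. heaviest_edges E w v (c v) (H v)"
    and "bij_betw lab V {0..<n}"
    and "k = nat \<lceil>log 2 (real n)\<rceil>"
    and "max_weight_candidate w (candidates E H lab k) S"
  shows "pdbep_feasible E c S \<and>
    weight w S \<ge> pdbep_opt E c w / (2 + 2 * real_of_int \<lceil>log 2 (real n)\<rceil>)"
proof
  have fin: "finite E"
    using assms(1) by (rule simple_graph_finite_edges)
  have S: "S \<in> candidates E H lab k" and
    max: "\<And>C. C \<in> candidates E H lab k \<Longrightarrow> weight w C \<le> weight w S"
    using assms(8) by (auto simp: max_weight_candidate_def)
  have H: "H v \<subseteq> incident_edges E v" "card (H v) = c v" if "v \<in> V" for v
    using that assms(5) by (auto simp: heaviest_edges_def)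
  have Hfin: "finite (H v)" if "v \<in> V" for v
    using H(1) [OF that] fin by (auto simp: incident_edges_def intro: finite_subset)
  show "pdbep_feasible E c S"
    using assms(1) _ S by (rule candidates_feasible) (use H Hfin in auto)
  have lab: "lab v < 2 ^ k" if "v \<in> V" for v
  proof -
    have "lab v < n"
      using that assms(6) by (auto dest: bij_betwE)
    then show ?thesis
      using le_two_power_ceiling_log2 [of n] assms(7) by simp
  qed
  \<comment> \<open>The constant adds 2 for \<open>T_set E H\<close>, whose edges count twice, and
    \<open>2 * k\<close> for the candidates covering \<open>E2_set E H\<close>.\<close>
  have "weight w F \<le> (2 + 2 * real k) * weight w S" if "pdbep_feasible E c F" for F
  proof -
    have "weight w F \<le> 2 * weight w (T_set E H) + weight w (E2_set E H)"
      using weight_feasible_le [OF assms(1,3,5) that] sum_weight_heaviest [OF assms(1) H(1)]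
      by simp
    also have "\<dots> \<le> 2 * weight w S + 2 * real k * weight w S"
      using max lab assms(1,3,6)
      by (intro add_mono weight_E2_set_le [of V])
         (auto simp: bij_betw_def candidates_def)
    finally show ?thesis by (simp add: algebra_simps)
  qed
  \<comment> \<open>Finiteness and the feasible empty set make the \<open>Max\<close> in
    \<open>pdbep_opt\<close> a genuine maximum, so a bound on every feasible solution bounds
    it.\<close>
  moreover have "finite {F. pdbep_feasible E c F}"
    by (rule finite_subset [of _ "Pow E"]) (use fin in \<open>auto simp: pdbep_feasible_def\<close>)
  moreover have "pdbep_feasible E c {}"
    by (simp add: pdbep_feasible_def)
  ultimately have "pdbep_opt E c w \<le> (2 + 2 * real k) * weight w S"
    unfolding pdbep_opt_def by (subst Max_le_iff) auto
  then have "pdbep_opt E c w / (2 + 2 * real k) \<le> weight w S"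
    by (subst pos_divide_le_eq) (auto simp: mult.commute)
  moreover have "real k = real_of_int \<lceil>log 2 (real n)\<rceil>"
    using ceiling_log2_nonneg [of n] unfolding assms(7) by (rule of_nat_nat)
  ultimately show "weight w S \<ge> pdbep_opt E c w / (2 + 2 * real_of_int \<lceil>log 2 (real n)\<rceil>)"
    by simp
qed

end
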